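(* Let $\mathcal{F}$ be either of the following two families of pairs $(k,G)$: (i) all pairs where $k\ge2$ is an integer and $G$ is a connected bipartite $0_k$-graph with degree set $\{k,2k\}$; (ii) all pairs where $k\ge 2$ is an integer and $G$ is a connected nonbipartite $0_k$-graph with degree set $\{k,2k\}$. Then, for each of these two families $\mathcal F$: (a) there is no absolute constant $C$ such that $\chi_k'(G)\le k+C$ for every $(k,G)\in\mathcal F$; (b) there is no function $f$, defined on the integers $k\ge2$ with real values and satisfying $f(k)=o(k)$ as $k\to\infty$, such that $\chi_k'(G)\le k+f(k)$ for every $(k,G)\in\mathcal F$.
   Context: All graphs are finite and simple. For an integer $k\ge 2$, a $\chi_k'$-coloring of a graph $G$ is an edge-coloring (not necessarily proper) such that, for each color, the subgraph spanned by the edges of that color has all nonzero degrees congruent to $1\pmod k$. The mod $k$ chromatic index $\chi_k'(G)$ is the minimum number of colors in a $\chi_k'$-coloring of $G$. A graph $G$ is a $0_k$-graph if $d_G(v)\equiv 0\pmod k$ for every $v\in V(G)$. The degree set of $G$ is the set $\{d_G(v): v\in V(G)\}$. *)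

theory Defs
  imports "HOL-Library.Landau_Symbols" "HOL-Number_Theory.Cong"
begin

text \<open>A graph is a pair of a vertex set and a set of edges, each edge being a two-element set of
  vertices.\<close>

type_synonym 'a graph = "'a set \<times> 'a set set"

abbreviation verts :: "'a graph \<Rightarrow> 'a set" where "verts \<equiv> fst"
abbreviation edges :: "'a graph \<Rightarrow> 'a set set" where "edges \<equiv> snd"

definition finite_simple_graph :: "'a graph \<Rightarrow> bool" where
  "finite_simple_graph G \<longleftrightarrow>
     finite (verts G) \<and> (\<forall>e\<in>edges G. e \<subseteq> verts G \<and> card e = 2)"

definition vertex_degree :: "'a graph \<Rightarrow> 'a \<Rightarrow> nat" where
  "vertex_degree G v = card {e \<in> edges G. v \<in> e}"

definition degree_set :: "'a graph \<Rightarrow> nat set" where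
  "degree_set G = vertex_degree G ` verts G"

definition connected_graph :: "'a graph \<Rightarrow> bool" where
  "connected_graph G \<longleftrightarrow> verts G \<noteq> {} \<and>
     (\<forall>u\<in>verts G. \<forall>v\<in>verts G. (u, v) \<in> {(x, y). {x, y} \<in> edges G}\<^sup>*)"

definition bipartite :: "'a graph \<Rightarrow> bool" where
  "bipartite G \<longleftrightarrow> (\<exists>A B. A \<union> B = verts G \<and> A \<inter> B = {} \<and>
     (\<forall>e\<in>edges G. \<exists>a\<in>A. \<exists>b\<in>B. e = {a, b}))"

definition zero_mod_graph :: "nat \<Rightarrow> 'a graph \<Rightarrow> bool" where
  "zero_mod_graph k G \<longleftrightarrow> (\<forall>v\<in>verts G. [vertex_degree G v = 0] (mod k))"

text \<open>Keeping all vertices in a colour class only adds vertices of degree zero, which the condition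
  below ignores.\<close>

definition colour_class :: "'a graph \<Rightarrow> ('a set \<Rightarrow> 'c) \<Rightarrow> 'c \<Rightarrow> 'a graph" where
  "colour_class G c i = (verts G, {e \<in> edges G. c e = i})"

definition mod_colouring :: "nat \<Rightarrow> 'a graph \<Rightarrow> ('a set \<Rightarrow> 'c) \<Rightarrow> bool" where
  "mod_colouring k G c \<longleftrightarrow>
     (\<forall>i. \<forall>v\<in>verts G. vertex_degree (colour_class G c i) v \<noteq> 0 \<longrightarrow>
        [vertex_degree (colour_class G c i) v = 1] (mod k))"

definition mod_chromatic_index :: "nat \<Rightarrow> 'a graph \<Rightarrow> nat" where
  "mod_chromatic_index k G =
     (LEAST n. \<exists>c :: 'a set \<Rightarrow> nat. mod_colouring k G c \<and> card (c ` edges G) = n)"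

text \<open>The minimum is over a nonempty set: giving every edge its own colour is always admissible.\<close>

lemma mod_chromatic_index_attained:
  fixes G :: "'a graph"
  assumes "finite_simple_graph G"
  shows "\<exists>c :: 'a set \<Rightarrow> nat. mod_colouring k G c \<and> card (c ` edges G) = mod_chromatic_index k G"
proof -
  have "edges G \<subseteq> Pow (verts G)" "finite (verts G)"
    using assms by (auto simp: finite_simple_graph_def)
  then have "finite (edges G)"
    by (meson finite_Pow_iff finite_subset)
  then obtain c :: "'a set \<Rightarrow> nat" where inj: "inj_on c (edges G)"
    using finite_imp_inj_to_nat_seg by blast
  have le1: "vertex_degree (colour_class G c i) v \<le> 1" for i v
  proof -
    let ?S = "{e \<in> edges G. c e = i \<and> v \<in> e}"
    have "card ?S \<le> Suc 0"
      using inj \<open>finite (edges G)\<close> by (subst card_le_Suc0_iff_eq) (auto simp: inj_on_def)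
    then show ?thesis
      by (simp add: vertex_degree_def colour_class_def)
  qed
  have "vertex_degree (colour_class G c i) v = 1" if "vertex_degree (colour_class G c i) v \<noteq> 0" for i v
    using that le1[of i v] by linarith
  then have "mod_colouring k G c"
    unfolding mod_colouring_def by simp
  then have "\<exists>n. \<exists>c :: 'a set \<Rightarrow> nat. mod_colouring k G c \<and> card (c ` edges G) = n"
    by blast
  from LeastI_ex[OF this] show ?thesis
    unfolding mod_chromatic_index_def .
qed

text \<open>Every finite graph is isomorphic to one whose vertices are natural numbers, so vertices are
  taken in \<^typ>\<open>nat\<close> in order to have the two families as sets.\<close>

definition bipartite_family :: "(nat \<times> nat graph) set" where
  "bipartite_family = {(k, G). 2 \<le> k \<and> finite_simple_graph G \<and> connected_graph G \<and>
     bipartite G \<and> zero_mod_graph k G \<and> degree_set G = {k, 2 * k}}"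

definition nonbipartite_family :: "(nat \<times> nat graph) set" where
  "nonbipartite_family = {(k, G). 2 \<le> k \<and> finite_simple_graph G \<and> connected_graph G \<and>
     \<not> bipartite G \<and> zero_mod_graph k G \<and> degree_set G = {k, 2 * k}}"

end

theory Submission
  imports Defs
begin

text \<open>
  In a \<open>\<chi>'\<^sub>k\<close>-colouring a vertex of degree \<open>k\<close> sees every colour at most once, and a vertex of
  degree \<open>2 * k\<close> sees at most one colour more than once, and that one exactly \<open>k + 1\<close> times. Take a
  bipartite graph with \<open>3 * k\<close> vertices of degree \<open>k\<close> on one side, forming \<open>A\<close>, and \<open>3 * k / 2\<close>
  vertices of degree \<open>2 * k\<close> on the other, forming \<open>B\<close>. If \<open>r\<close> vertices of \<open>B\<close> repeat a given
  colour, then that colour has at most \<open>min (3 * k) (3 * k / 2 + k * r)\<close> edges. The two terms agree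
  at \<open>r = 3 / 2\<close>, the value needed on average if \<open>k\<close> colours are to suffice. But \<open>r\<close> is an
  integer, and for integers the minimum is at most \<open>2 * k + k * r / 2\<close>, which is below \<open>3 * k\<close> at
  \<open>r = 3 / 2\<close>. Each vertex of \<open>B\<close> repeats at most one colour, so the values \<open>r\<close> add up to at most \<open>3 * k / 2\<close>, and the
  \<open>3 * k\<^sup>2\<close> edges force at least \<open>9 * k / 8\<close> colours. This is a linear excess over \<open>k\<close>
  (\<open>crossing_edges_le_colours\<close>).

  For every even \<open>k = 2 * m \<ge> 4\<close>, a blow-up of a hexagon is such a graph, and it is connected. The
  count tolerates a bounded number of edges inside \<open>A\<close> or \<open>B\<close>, so a nonbipartite example
  arises by switching two edges \<open>ab\<close>, \<open>a'b'\<close> into \<open>aa'\<close>, \<open>bb'\<close>, which keeps all degrees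
  and creates a triangle; at least \<open>9 * k / 8 - 1\<close> colours are still needed
  (\<open>mod_chromatic_index_lower\<close>). A constant being \<open>o(k)\<close>, the statement about constants
  follows from the one about \<open>o(k)\<close>.
\<close>

section \<open>A lower bound on the number of colours\<close>

lemma vertex_degree_colour_class:
  "vertex_degree (colour_class G c i) v = card {e \<in> edges G. c e = i \<and> v \<in> e}"
  unfolding vertex_degree_def colour_class_def
  by (rule arg_cong[of _ _ card]) auto

lemma finite_edges:
  assumes "finite_simple_graph G"
  shows "finite (edges G)"
proof -
  have "edges G \<subseteq> Pow (verts G)" "finite (verts G)"
    using assms by (auto simp: finite_simple_graph_def)
  then show ?thesis
    by (meson finite_Pow_iff finite_subset)
qed

lemma colour_degree_le:
  assumes "finite_simple_graph G"
  shows "vertex_degree (colour_class G c i) v \<le> vertex_degree G v"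
  unfolding vertex_degree_colour_class
  unfolding vertex_degree_def
  using finite_edges[OF assms] by (intro card_mono) auto

lemma colour_degree_cases:
  assumes "mod_colouring k G c" "v \<in> verts G"
  obtains "vertex_degree (colour_class G c i) v = 0"
  | q where "vertex_degree (colour_class G c i) v = 1 + q * k"
proof (cases "vertex_degree (colour_class G c i) v = 0")
  case False
  let ?d = "vertex_degree (colour_class G c i) v"
  have "[?d = 1] (mod k)"
    using assms False unfolding mod_colouring_def by blast
  moreover have "1 \<le> ?d" using False by simp
  ultimately obtain q where "?d = q * k + 1"
    using cong_le_nat by blast
  then have "?d = 1 + q * k" by simp
  then show ?thesis by (rule that(2))
qed (rule that(1))

lemma colour_degree_le_1:
  assumes "finite_simple_graph G" "mod_colouring k G c" "v \<in> verts G" "vertex_degree G v \<le> k"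
  shows "vertex_degree (colour_class G c i) v \<le> 1"
  using assms(2,3)
proof (cases rule: colour_degree_cases[where i = i])
  case (2 q)
  have "1 + q * k \<le> k"
    using colour_degree_le[OF assms(1), of c i v] assms(4) 2 by linarith
  then have "q = 0" by (cases q) auto
  then show ?thesis using 2 by simp
qed simp

lemma colour_degree_le_Suc:
  assumes "finite_simple_graph G" "mod_colouring k G c" "v \<in> verts G" "vertex_degree G v \<le> 2 * k"
  shows "vertex_degree (colour_class G c i) v \<le> Suc k"
  using assms(2,3)
proof (cases rule: colour_degree_cases[where i = i])
  case (2 q)
  have "1 + q * k \<le> 2 * k"
    using colour_degree_le[OF assms(1), of c i v] assms(4) 2 by linarith
  then have "q * k < 2 * k" by linarith
  then have "q \<le> 1" by simp
  then have "q * k \<le> 1 * k" by (rule mult_right_mono) simp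
  then show ?thesis using 2 by simp
qed simp

text \<open>A colour seen twice at a vertex is seen at least \<open>k + 1\<close> times there, so a degree of at most
  \<open>2 * k\<close> has no room for two such colours.\<close>

lemma repeated_colour_unique:
  assumes fsg: "finite_simple_graph G" and col: "mod_colouring k G c" and v: "v \<in> verts G"
    and deg: "vertex_degree G v \<le> 2 * k"
    and i: "1 < vertex_degree (colour_class G c i) v"
    and j: "1 < vertex_degree (colour_class G c j) v"
  shows "i = j"
proof (rule ccontr)
  assume ne: "i \<noteq> j"
  have large: "k < vertex_degree (colour_class G c l) v"
    if "1 < vertex_degree (colour_class G c l) v" for l
    using col v
  proof (cases rule: colour_degree_cases[where i = l])
    case 1
    then show ?thesis using that by simp
  next
    case (2 q)
    then have "1 \<le> q" using that by (cases q) auto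
    then have "1 * k \<le> q * k" by (rule mult_right_mono) simp
    then show ?thesis using 2 by linarith
  qed
  let ?E = "\<lambda>l. {e \<in> edges G. c e = l \<and> v \<in> e}"
  have fin: "finite (edges G)" by (rule finite_edges[OF fsg])
  have "card (?E i) + card (?E j) = card (?E i \<union> ?E j)"
    using fin ne by (intro card_Un_disjoint[symmetric]) auto
  also have "\<dots> \<le> vertex_degree G v"
    unfolding vertex_degree_def using fin by (intro card_mono) auto
  finally have "card (?E i) + card (?E j) \<le> 2 * k" using deg by simp
  then show False
    using large[OF i] large[OF j] unfolding vertex_degree_colour_class by linarith
qed

lemma card_edges_meeting_le:
  assumes "finite S" "\<And>e. e \<in> X \<Longrightarrow> e \<in> edges G \<and> c e = i \<and> e \<inter> S \<noteq> {}"
    and "finite (edges G)"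
  shows "card X \<le> (\<Sum>v\<in>S. vertex_degree (colour_class G c i) v)"
proof -
  have "card X \<le> card (\<Union>v\<in>S. {e \<in> edges G. c e = i \<and> v \<in> e})"
    using assms by (intro card_mono) auto
  also have "\<dots> \<le> (\<Sum>v\<in>S. vertex_degree (colour_class G c i) v)"
    unfolding vertex_degree_colour_class using assms(1) by (rule card_UN_le)
  finally show ?thesis .
qed

text \<open>Each vertex of \<open>A\<close> meets at most one edge of a colour. A vertex of \<open>B\<close> meets at most one
  too, except that it meets at most \<open>k\<close> more if it repeats the colour. So a colour repeated at \<open>r\<close>
  vertices has at most \<open>3 * k\<close> and at most \<open>3 * k / 2 + k * r\<close> crossing edges. As functions of an
  integer \<open>r\<close>, the smaller of the two lies below the line through its values \<open>5 * k / 2\<close> and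
  \<open>3 * k\<close> at \<open>r = 1\<close> and \<open>r = 2\<close>, and this linear bound can be summed over the colours.\<close>

lemma crossing_edges_le_colours:
  assumes fsg: "finite_simple_graph G" and col: "mod_colouring k G c"
    and A: "A \<subseteq> verts G" "\<And>a. a \<in> A \<Longrightarrow> vertex_degree G a \<le> k" "card A = 3 * k"
    and B: "B \<subseteq> verts G" "\<And>b. b \<in> B \<Longrightarrow> vertex_degree G b \<le> 2 * k" "2 * card B = 3 * k"
    and X: "X \<subseteq> edges G" "\<And>e. e \<in> X \<Longrightarrow> e \<inter> A \<noteq> {} \<and> e \<inter> B \<noteq> {}"
  shows "4 * card X \<le> k * (8 * card (c ` edges G) + 3 * k)"
proof -
  define repeaters where "repeaters i = {b \<in> B. 1 < vertex_degree (colour_class G c i) b}" for i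
  let ?X = "\<lambda>i. {e \<in> X. c e = i}"
  have finE: "finite (edges G)" by (rule finite_edges[OF fsg])
  have finA: "finite A" and finB: "finite B"
    using A(1) B(1) fsg by (auto simp: finite_simple_graph_def intro: finite_subset)
  have colour: "2 * card (?X i) \<le> 4 * k + k * card (repeaters i)" for i
  proof -
    have "card (?X i) \<le> (\<Sum>a\<in>A. vertex_degree (colour_class G c i) a)"
      using X finA finE by (intro card_edges_meeting_le) auto
    also have "\<dots> \<le> (\<Sum>a\<in>A. 1)"
      using A by (intro sum_mono colour_degree_le_1[OF fsg col]) auto
    finally have XA: "card (?X i) \<le> 3 * k" using A(3) by simp
    have "card (?X i) \<le> (\<Sum>b\<in>B. vertex_degree (colour_class G c i) b)"
      using X finB finE by (intro card_edges_meeting_le) auto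
    also have "\<dots> \<le> (\<Sum>b\<in>B. 1 + (if b \<in> repeaters i then k else 0))"
    proof (intro sum_mono)
      fix b assume b: "b \<in> B"
      then have "vertex_degree (colour_class G c i) b \<le> Suc k"
        using B by (intro colour_degree_le_Suc[OF fsg col]) auto
      then show "vertex_degree (colour_class G c i) b \<le> 1 + (if b \<in> repeaters i then k else 0)"
        using b by (auto simp: repeaters_def)
    qed
    also have "\<dots> = card B + k * card (repeaters i)"
    proof -
      have "B \<inter> repeaters i = repeaters i" by (auto simp: repeaters_def)
      then show ?thesis
        using finB by (simp only: sum.distrib) (simp add: sum.inter_restrict[symmetric] mult.commute)
    qed
    finally have XB: "card (?X i) \<le> card B + k * card (repeaters i)" .
    consider "card (repeaters i) = 0" | "card (repeaters i) = 1" | "2 \<le> card (repeaters i)" by linarith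
    then show ?thesis
    proof cases
      case 3
      then have "k * 2 \<le> k * card (repeaters i)" by (rule mult_left_mono) simp
      then show ?thesis using XA by linarith
    qed (use XB B(3) in auto)
  qed
  have "(\<Sum>i\<in>c ` edges G. card (repeaters i)) = card (\<Union>i\<in>c ` edges G. repeaters i)"
  proof (rule card_UN_disjoint[symmetric])
    show "\<forall>i\<in>c ` edges G. \<forall>j\<in>c ` edges G. i \<noteq> j \<longrightarrow> repeaters i \<inter> repeaters j = {}"
      using repeated_colour_unique[OF fsg col] B unfolding repeaters_def by blast
  qed (use finE finB in \<open>auto simp: repeaters_def\<close>)
  also have "\<dots> \<le> card B"
    using finB by (intro card_mono) (auto simp: repeaters_def)
  finally have reps: "(\<Sum>i\<in>c ` edges G. card (repeaters i)) \<le> card B" .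
  have "X = (\<Union>i\<in>c ` edges G. ?X i)" using X by auto
  then have "card X \<le> (\<Sum>i\<in>c ` edges G. card (?X i))"
    using card_UN_le[of "c ` edges G" ?X] finE by simp
  then have "2 * card X \<le> (\<Sum>i\<in>c ` edges G. 2 * card (?X i))"
    by (simp add: sum_distrib_left[symmetric])
  also have "\<dots> \<le> (\<Sum>i\<in>c ` edges G. 4 * k + k * card (repeaters i))"
    by (intro sum_mono colour)
  also have "\<dots> = 4 * k * card (c ` edges G) + k * (\<Sum>i\<in>c ` edges G. card (repeaters i))"
    by (simp add: sum.distrib sum_distrib_left)
  also have "\<dots> \<le> 4 * k * card (c ` edges G) + k * card B"
    using reps by simp
  finally have "4 * card X \<le> 8 * (k * card (c ` edges G)) + k * (2 * card B)"
    by simp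
  then show ?thesis unfolding B(3) by (simp add: algebra_simps)
qed

section \<open>A dense bipartite graph\<close>

text \<open>Vertices below \<open>6 * m\<close> are on one side, those from \<open>6 * m\<close> to \<open>9 * m\<close> on the other. The
  residue classes modulo 3 split the sides into parts of size \<open>2 * m\<close> and \<open>m\<close>. Two parts on
  different sides are completely joined, unless they belong to the same residue, so the parts form
  \<open>K\<^sub>3\<^sub>,\<^sub>3\<close> minus a perfect matching, a hexagon.\<close>

definition hexagon_edges :: "nat \<Rightarrow> nat set set" where
  "hexagon_edges m = {{a, b} | a b. a < 6 * m \<and> b \<in> {6 * m..<9 * m} \<and> a mod 3 \<noteq> b mod 3}"

lemma hexagon_edgeE:
  assumes "e \<in> hexagon_edges m"
  obtains a b where "e = {a, b}" "a < 6 * m" "6 * m \<le> b" "b < 9 * m" "a mod 3 \<noteq> b mod 3"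
proof -
  have "\<exists>a b. e = {a, b} \<and> a < 6 * m \<and> b \<in> {6 * m..<9 * m} \<and> a mod 3 \<noteq> b mod 3"
    using assms unfolding hexagon_edges_def by (rule CollectD)
  then show ?thesis using that by (elim exE conjE) simp
qed

lemma hexagon_edge_iff:
  assumes "a < 6 * m"
  shows "{a, b} \<in> hexagon_edges m \<longleftrightarrow> b \<in> {6 * m..<9 * m} \<and> a mod 3 \<noteq> b mod 3"
proof
  assume "{a, b} \<in> hexagon_edges m"
  then obtain x y where xy: "{a, b} = {x, y}" "6 * m \<le> y" "y < 9 * m" "x mod 3 \<noteq> y mod 3"
    by (rule hexagon_edgeE)
  then have "a = x" "b = y" using assms by (auto simp: doubleton_eq_iff)
  then show "b \<in> {6 * m..<9 * m} \<and> a mod 3 \<noteq> b mod 3" using xy by simp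
next
  assume "b \<in> {6 * m..<9 * m} \<and> a mod 3 \<noteq> b mod 3"
  then show "{a, b} \<in> hexagon_edges m" using assms unfolding hexagon_edges_def by blast
qed

lemma finite_simple_hexagon: "finite_simple_graph ({..<9 * m}, hexagon_edges m)"
  unfolding finite_simple_graph_def
proof (intro conjI ballI)
  fix e assume "e \<in> edges ({..<9 * m}, hexagon_edges m)"
  then obtain a b where e: "e = {a, b}" "a < 6 * m" "6 * m \<le> b" "b < 9 * m"
    by (auto elim: hexagon_edgeE)
  then have "a \<noteq> b" by linarith
  then show "card e = 2" using e(1) by simp
  show "e \<subseteq> verts ({..<9 * m}, hexagon_edges m)" using e by simp
qed simp

lemma card_residue_class_mod3:
  fixes p q r :: nat
  assumes "r < 3"
  shows "card {x \<in> {3 * p..<3 * q}. x mod 3 = r} = q - p"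
proof -
  have "{x \<in> {3 * p..<3 * q}. x mod 3 = r} = (\<lambda>j. 3 * j + r) ` {p..<q}"
  proof (intro equalityI subsetI)
    fix x assume x: "x \<in> {x \<in> {3 * p..<3 * q}. x mod 3 = r}"
    then have "x = 3 * (x div 3) + r" "x div 3 \<in> {p..<q}" by auto
    then show "x \<in> (\<lambda>j. 3 * j + r) ` {p..<q}" by blast
  qed (use assms in auto)
  moreover have "inj_on (\<lambda>j. 3 * j + r) {p..<q}" by (auto intro: inj_onI)
  ultimately show ?thesis by (simp add: card_image)
qed

lemma card_not_residue_class_mod3:
  fixes p q s :: nat
  shows "card {x \<in> {3 * p..<3 * q}. s mod 3 \<noteq> x mod 3} = 2 * (q - p)"
proof -
  let ?R = "{x \<in> {3 * p..<3 * q}. x mod 3 = s mod 3}"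
  have "{x \<in> {3 * p..<3 * q}. s mod 3 \<noteq> x mod 3} = {3 * p..<3 * q} - ?R"
    by auto
  moreover have "card ({3 * p..<3 * q} - ?R) = card {3 * p..<3 * q} - card ?R"
    by (rule card_Diff_subset) auto
  moreover have "card ?R = q - p"
    by (rule card_residue_class_mod3) simp
  moreover have "3 * q - 3 * p - (q - p) = 2 * (q - p)"
    by arith
  ultimately show ?thesis
    by (simp only: card_atLeastLessThan)
qed

lemma add_six_mult_mod3: "(6 * m + j) mod 3 = j mod (3 :: nat)"
proof -
  have "6 * m + j = j + 3 * (2 * m)" by simp
  then show ?thesis by (simp only: mod_mult_self2)
qed

lemma degree_eq_card_neighbours:
  assumes "\<And>e. e \<in> E \<and> v \<in> e \<longleftrightarrow> (\<exists>u\<in>N. e = {v, u})"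
  shows "vertex_degree (V, E) v = card N"
proof -
  have "{e \<in> E. v \<in> e} = (\<lambda>u. {v, u}) ` N" using assms by auto
  moreover have "inj_on (\<lambda>u. {v, u}) N" by (auto intro!: inj_onI simp: doubleton_eq_iff)
  ultimately show ?thesis by (simp add: vertex_degree_def card_image)
qed

lemma hexagon_degree_low:
  assumes "a < 6 * m"
  shows "vertex_degree (V, hexagon_edges m) a = 2 * m"
proof -
  have "vertex_degree (V, hexagon_edges m) a =
      card {b \<in> {3 * (2 * m)..<3 * (3 * m)}. a mod 3 \<noteq> b mod 3}"
  proof (rule degree_eq_card_neighbours)
    fix e
    show "e \<in> hexagon_edges m \<and> a \<in> e \<longleftrightarrow>
        (\<exists>b\<in>{b \<in> {3 * (2 * m)..<3 * (3 * m)}. a mod 3 \<noteq> b mod 3}. e = {a, b})"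
    proof
      assume "e \<in> hexagon_edges m \<and> a \<in> e"
      then obtain x y where xy: "e = {x, y}" "a \<in> {x, y}" "6 * m \<le> y" "y < 9 * m" "x mod 3 \<noteq> y mod 3"
        by (auto elim: hexagon_edgeE)
      moreover from this assms have "a = x" by auto
      ultimately show "\<exists>b\<in>{b \<in> {3 * (2 * m)..<3 * (3 * m)}. a mod 3 \<noteq> b mod 3}. e = {a, b}"
        by (intro bexI[of _ y]) simp_all
    next
      assume "\<exists>b\<in>{b \<in> {3 * (2 * m)..<3 * (3 * m)}. a mod 3 \<noteq> b mod 3}. e = {a, b}"
      then obtain b where "b \<in> {b \<in> {3 * (2 * m)..<3 * (3 * m)}. a mod 3 \<noteq> b mod 3}" "e = {a, b}"
        by (rule bexE)
      then show "e \<in> hexagon_edges m \<and> a \<in> e"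
        using assms by (simp add: hexagon_edge_iff)
    qed
  qed
  also have "\<dots> = 2 * (3 * m - 2 * m)" by (rule card_not_residue_class_mod3)
  finally show ?thesis by simp
qed

lemma hexagon_degree_high:
  assumes "b \<in> {6 * m..<9 * m}"
  shows "vertex_degree (V, hexagon_edges m) b = 4 * m"
proof -
  have "vertex_degree (V, hexagon_edges m) b =
      card {a \<in> {3 * 0..<3 * (2 * m)}. b mod 3 \<noteq> a mod 3}"
  proof (rule degree_eq_card_neighbours)
    fix e
    show "e \<in> hexagon_edges m \<and> b \<in> e \<longleftrightarrow>
        (\<exists>a\<in>{a \<in> {3 * 0..<3 * (2 * m)}. b mod 3 \<noteq> a mod 3}. e = {b, a})"
    proof
      assume "e \<in> hexagon_edges m \<and> b \<in> e"
      then obtain a c where "e = {a, c}" "b \<in> {a, c}" "a < 6 * m" "6 * m \<le> c" "a mod 3 \<noteq> c mod 3"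
        by (auto elim: hexagon_edgeE)
      moreover from this assms have "b = c" by auto
      ultimately show "\<exists>a\<in>{a \<in> {3 * 0..<3 * (2 * m)}. b mod 3 \<noteq> a mod 3}. e = {b, a}"
        by (intro bexI[of _ a]) (simp_all add: insert_commute)
    next
      assume "\<exists>a\<in>{a \<in> {3 * 0..<3 * (2 * m)}. b mod 3 \<noteq> a mod 3}. e = {b, a}"
      then obtain a where "a \<in> {a \<in> {3 * 0..<3 * (2 * m)}. b mod 3 \<noteq> a mod 3}" "e = {b, a}"
        by (rule bexE)
      then have "e = {a, b}" "a < 6 * m" "a mod 3 \<noteq> b mod 3" by auto
      then show "e \<in> hexagon_edges m \<and> b \<in> e"
        using assms by (simp add: hexagon_edge_iff)
    qed
  qed
  also have "\<dots> = 2 * (2 * m - 0)" by (rule card_not_residue_class_mod3)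
  finally show ?thesis by simp
qed

lemma card_hexagon_edges: "card (hexagon_edges m) = 12 * m * m"
proof -
  let ?star = "\<lambda>a. {e \<in> hexagon_edges m. a \<in> e}"
  have card_star: "card (?star a) = 2 * m" if "a < 6 * m" for a
    using hexagon_degree_low[OF that, of UNIV] by (simp add: vertex_degree_def)
  have "hexagon_edges m = (\<Union>a\<in>{..<6 * m}. ?star a)"
    unfolding hexagon_edges_def by blast
  also have "card \<dots> = (\<Sum>a<6 * m. card (?star a))"
  proof (rule card_UN_disjoint)
    show "\<forall>a\<in>{..<6 * m}. finite (?star a)"
      using finite_edges[OF finite_simple_hexagon[of m]] by simp
    have "a = a'" if "e \<in> hexagon_edges m" "a \<in> e" "a' \<in> e" "a < 6 * m" "a' < 6 * m" for e a a'
    proof -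
      obtain x y where "e = {x, y}" "6 * m \<le> y"
        using \<open>e \<in> hexagon_edges m\<close> by (rule hexagon_edgeE)
      then show ?thesis using that by auto
    qed
    then show "\<forall>a\<in>{..<6 * m}. \<forall>a'\<in>{..<6 * m}. a \<noteq> a' \<longrightarrow> ?star a \<inter> ?star a' = {}"
      by blast
  qed simp
  also have "\<dots> = (\<Sum>a<6 * m. 2 * m)"
    using card_star by (intro sum.cong) auto
  finally show ?thesis by simp
qed

text \<open>For any two vertices on the large side some residue differs from both of theirs, so they share
  the small-side vertices of that residue as neighbours. The two deleted edges are those that
  switching will remove; the root 1 is an end of neither, and the shared neighbours chosen below
  avoid them as well.\<close>

lemma connected_hexagon_minus_two:
  assumes m: "2 \<le> m"
    and sub: "hexagon_edges m - {{0, 6 * m + 1}, {3, 6 * m + 4}} \<subseteq> E"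
  shows "connected_graph ({..<9 * m}, E)"
proof -
  define R where "R = {(x, y). {x, y} \<in> E}"
  have symR: "sym R" unfolding R_def by (auto intro!: symI simp: insert_commute)
  have edge: "(a, b) \<in> R" if "a < 6 * m" "b \<in> {6 * m..<9 * m}" "a mod 3 \<noteq> b mod 3"
    "b \<noteq> 6 * m + 1 \<or> a \<noteq> 0" "b \<noteq> 6 * m + 4 \<or> a \<noteq> 3" for a b
  proof -
    have "{a, b} \<in> hexagon_edges m" using that by (simp add: hexagon_edge_iff)
    moreover have "{a, b} \<noteq> {0, 6 * m + 1}" "{a, b} \<noteq> {3, 6 * m + 4}"
      using that m by (auto simp: doubleton_eq_iff)
    ultimately have "{a, b} \<in> E" by (intro subsetD[OF sub]) simp
    then show ?thesis by (simp add: R_def)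
  qed
  have sym: "(x, y) \<in> R\<^sup>* \<Longrightarrow> (y, x) \<in> R\<^sup>*" for x y
    using sym_rtrancl[OF symR] by (rule symD)
  have low: "(1, a) \<in> R\<^sup>*" if a: "a < 6 * m" for a
  proof -
    define j where "j = (if a mod 3 = 2 then 0 else 2 :: nat)"
    have j: "j < 3 * m" "j \<noteq> 1" "j \<noteq> 4" "1 mod 3 \<noteq> j mod 3" "a mod 3 \<noteq> j mod 3"
      using m by (simp_all add: j_def)
    have "(1, 6 * m + j) \<in> R" using j m by (intro edge) (simp_all add: add_six_mult_mod3)
    moreover have "(a, 6 * m + j) \<in> R" using j a by (intro edge) (simp_all add: add_six_mult_mod3)
    then have "(6 * m + j, a) \<in> R" by (rule symD[OF symR])
    ultimately show ?thesis by (meson r_into_rtrancl rtrancl_into_rtrancl)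
  qed
  have high: "(1, b) \<in> R\<^sup>*" if b: "b \<in> {6 * m..<9 * m}" for b
  proof -
    define a where "a = (if b mod 3 = 1 then 2 else 1 :: nat)"
    have a: "a < 6 * m" "a \<noteq> 0" "a \<noteq> 3" "a mod 3 \<noteq> b mod 3"
      using m by (simp_all add: a_def)
    have "(a, b) \<in> R" using a b by (intro edge) simp_all
    moreover have "(1, a) \<in> R\<^sup>*" by (rule low[OF a(1)])
    ultimately show ?thesis by (rule rtrancl_into_rtrancl[rotated])
  qed
  have root: "(1, v) \<in> R\<^sup>*" if "v < 9 * m" for v
    using low[of v] high[of v] that by (cases "v < 6 * m") auto
  have "(u, v) \<in> R\<^sup>*" if "u < 9 * m" "v < 9 * m" for u v
    using sym[OF root[OF that(1)]] root[OF that(2)] by (rule rtrancl_trans)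
  then show ?thesis
    using m unfolding connected_graph_def R_def by (auto simp: lessThan_empty_iff)
qed

section \<open>Switching two edges\<close>

text \<open>Two sides of the 4-cycle \<open>a, b, b', a'\<close> are exchanged for the other two. Each of its
  vertices is an end of one removed and one added edge, so no degree changes.\<close>

definition switch :: "'a \<Rightarrow> 'a \<Rightarrow> 'a \<Rightarrow> 'a \<Rightarrow> 'a set set \<Rightarrow> 'a set set" where
  "switch a b a' b' E = E - {{a, b}, {a', b'}} \<union> {{a, a'}, {b, b'}}"

lemma switch_degree_end:
  assumes "finite E" "{a, b} \<in> E" "{a, a'} \<notin> E" "distinct [a, b, a', b']"
  shows "vertex_degree (V, switch a b a' b' E) a = vertex_degree (V, E) a"
proof -
  let ?S = "{e \<in> E. a \<in> e}"
  have "{e \<in> switch a b a' b' E. a \<in> e} = insert {a, a'} (?S - {{a, b}})"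
    using assms(4) unfolding switch_def by auto
  moreover have "card (insert {a, a'} (?S - {{a, b}})) = Suc (card (?S - {{a, b}}))"
    using assms by (intro card_insert_disjoint) auto
  moreover have "Suc (card (?S - {{a, b}})) = card ?S"
    using assms by (intro card_Suc_Diff1) auto
  ultimately show ?thesis by (simp add: vertex_degree_def)
qed

lemma switch_degree:
  assumes "finite E" "{a, b} \<in> E" "{a', b'} \<in> E" "{a, a'} \<notin> E" "{b, b'} \<notin> E"
    "distinct [a, b, a', b']"
  shows "vertex_degree (V, switch a b a' b' E) v = vertex_degree (V, E) v"
proof -
  have sym1: "switch b a b' a' E = switch a b a' b' E"
    and sym2: "switch a' b' a b E = switch a b a' b' E"
    and sym3: "switch b' a' b a E = switch a b a' b' E"
    by (auto simp: switch_def insert_commute)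
  consider "v = a" | "v = b" | "v = a'" | "v = b'" | "v \<notin> {a, b, a', b'}" by blast
  then show ?thesis
  proof cases
    case 1
    then show ?thesis using assms by (simp add: switch_degree_end)
  next
    case 2
    then show ?thesis
      using switch_degree_end[of E b a b' a' V] assms by (auto simp: sym1 insert_commute)
  next
    case 3
    then show ?thesis
      using switch_degree_end[of E a' b' a b V] assms by (auto simp: sym2 insert_commute)
  next
    case 4
    then show ?thesis
      using switch_degree_end[of E b' a' b a V] assms by (auto simp: sym3 insert_commute)
  next
    case 5
    then have "{e \<in> switch a b a' b' E. v \<in> e} = {e \<in> E. v \<in> e}"
      unfolding switch_def by auto
    then show ?thesis by (simp add: vertex_degree_def)
  qed
qed

lemma triangle_not_bipartite:
  assumes "{x, y} \<in> edges G" "{y, z} \<in> edges G" "{x, z} \<in> edges G"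
  shows "\<not> bipartite G"
proof
  assume "bipartite G"
  then obtain A B where AB: "A \<inter> B = {}" "\<forall>e\<in>edges G. \<exists>a\<in>A. \<exists>b\<in>B. e = {a, b}"
    unfolding bipartite_def by metis
  have side: "u \<in> A \<longleftrightarrow> v \<notin> A" if "{u, v} \<in> edges G" for u v
  proof -
    obtain a b where "a \<in> A" "b \<in> B" "{u, v} = {a, b}"
      using AB(2)[rule_format, OF \<open>{u, v} \<in> edges G\<close>] by (elim bexE)
    then show ?thesis using AB(1) by (auto simp: doubleton_eq_iff)
  qed
  show False using side[OF assms(1)] side[OF assms(2)] side[OF assms(3)] by blast
qed

section \<open>Both families need many colours\<close>

text \<open>The hypotheses cover the hexagon graph and the graph obtained from it by switching, which lacks
  two of the \<open>12 * m\<^sup>2 = 3 * k\<^sup>2\<close> crossing edges. In the inequality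
  \<open>4 * |X| \<le> k * (8 * n + 3 * k)\<close> this loss costs 8 on the left, and increasing the number \<open>n\<close> of
  colours by one, which adds \<open>16 * m\<close> on the right, outweighs it.\<close>

lemma mod_chromatic_index_lower:
  assumes m: "2 \<le> m" and fsg: "finite_simple_graph ({..<9 * m}, E)"
    and deg: "\<And>v. v < 9 * m \<Longrightarrow>
      vertex_degree ({..<9 * m}, E) v = vertex_degree ({..<9 * m}, hexagon_edges m) v"
    and sub: "hexagon_edges m - {{0, 6 * m + 1}, {3, 6 * m + 4}} \<subseteq> E"
  shows "9 * (2 * m) \<le> 8 * mod_chromatic_index (2 * m) ({..<9 * m}, E) + 8"
proof -
  let ?G = "({..<9 * m}, E)"
  let ?X = "hexagon_edges m - {{0, 6 * m + 1}, {3, 6 * m + 4}}"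
  let ?n = "mod_chromatic_index (2 * m) ?G"
  obtain c :: "nat set \<Rightarrow> nat" where c: "mod_colouring (2 * m) ?G c" "card (c ` edges ?G) = ?n"
    using mod_chromatic_index_attained[OF fsg] by blast
  have "4 * card ?X \<le> 2 * m * (8 * card (c ` edges ?G) + 3 * (2 * m))"
  proof (rule crossing_edges_le_colours[OF fsg c(1), where A = "{..<6 * m}" and B = "{6 * m..<9 * m}"])
    show "?X \<subseteq> edges ?G" using sub by simp
    show "e \<inter> {..<6 * m} \<noteq> {} \<and> e \<inter> {6 * m..<9 * m} \<noteq> {}" if "e \<in> ?X" for e
    proof -
      have "e \<in> hexagon_edges m" using that by (rule DiffD1)
      then obtain a b where "e = {a, b}" "a < 6 * m" "6 * m \<le> b" "b < 9 * m"
        by (rule hexagon_edgeE)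
      then show ?thesis by simp
    qed
  qed (auto simp: deg hexagon_degree_low hexagon_degree_high)
  moreover have "12 * m * m \<le> card ?X + 2"
  proof -
    let ?D = "{{0, 6 * m + 1}, {3, 6 * m + 4}}"
    have "card (hexagon_edges m) - card ?D \<le> card ?X"
      by (rule diff_card_le_card_Diff) simp
    moreover have "card ?D \<le> 2" using card_length[of "[{0, 6 * m + 1}, {3, 6 * m + 4}]"] by simp
    ultimately show ?thesis unfolding card_hexagon_edges by linarith
  qed
  ultimately have "48 * m * m \<le> 2 * m * (8 * ?n + 6 * m) + 8"
    unfolding c(2) by simp
  then have "m * (18 * m) \<le> m * (8 * ?n + 8)"
    using m by (simp add: algebra_simps)
  then show ?thesis using m by simp
qed

lemma degree_set_hexagon_degrees:
  assumes "1 \<le> m"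
    and deg: "\<And>v. v < 9 * m \<Longrightarrow>
      vertex_degree ({..<9 * m}, E) v = vertex_degree ({..<9 * m}, hexagon_edges m) v"
  shows "degree_set ({..<9 * m}, E) = {2 * m, 2 * (2 * m)}"
    and "zero_mod_graph (2 * m) ({..<9 * m}, E)"
proof -
  have all: "vertex_degree ({..<9 * m}, E) v = (if v < 6 * m then 2 * m else 2 * (2 * m))"
    if "v < 9 * m" for v
    using that by (simp add: deg hexagon_degree_low hexagon_degree_high)
  have low: "0 < 9 * m" "0 < 6 * m" and high: "6 * m < 9 * m" "\<not> 6 * m < 6 * m"
    using assms(1) by auto
  show "degree_set ({..<9 * m}, E) = {2 * m, 2 * (2 * m)}"
  proof
    show "degree_set ({..<9 * m}, E) \<subseteq> {2 * m, 2 * (2 * m)}"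
      unfolding degree_set_def by (auto simp: all)
    have "vertex_degree ({..<9 * m}, E) 0 = 2 * m" "vertex_degree ({..<9 * m}, E) (6 * m) = 2 * (2 * m)"
      using all[OF low(1)] all[OF high(1)] low high by simp_all
    then have "{2 * m, 2 * (2 * m)} = vertex_degree ({..<9 * m}, E) ` {0, 6 * m}"
      by simp
    also have "\<dots> \<subseteq> vertex_degree ({..<9 * m}, E) ` {..<9 * m}"
      using low high by (intro image_mono) auto
    finally show "{2 * m, 2 * (2 * m)} \<subseteq> degree_set ({..<9 * m}, E)"
      by (simp add: degree_set_def)
  qed
  show "zero_mod_graph (2 * m) ({..<9 * m}, E)"
    unfolding zero_mod_graph_def by (auto simp: all cong_def)
qed

lemma bipartite_hexagon: "bipartite ({..<9 * m}, hexagon_edges m)"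
  unfolding bipartite_def
proof (intro exI conjI)
  show "{..<6 * m} \<union> {6 * m..<9 * m} = verts ({..<9 * m}, hexagon_edges m)" by auto
  show "\<forall>e\<in>edges ({..<9 * m}, hexagon_edges m). \<exists>a\<in>{..<6 * m}. \<exists>b\<in>{6 * m..<9 * m}. e = {a, b}"
  proof
    fix e assume "e \<in> edges ({..<9 * m}, hexagon_edges m)"
    then obtain a b where "e = {a, b}" "a \<in> {..<6 * m}" "b \<in> {6 * m..<9 * m}"
      by (auto elim: hexagon_edgeE)
    then show "\<exists>a\<in>{..<6 * m}. \<exists>b\<in>{6 * m..<9 * m}. e = {a, b}" by (intro bexI)
  qed
qed auto

lemma bipartite_family_lower:
  assumes "2 \<le> m"
  shows "\<exists>G. (2 * m, G) \<in> bipartite_family \<and> 9 * (2 * m) \<le> 8 * mod_chromatic_index (2 * m) G + 8"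
proof -
  let ?G = "({..<9 * m}, hexagon_edges m)"
  have "9 * (2 * m) \<le> 8 * mod_chromatic_index (2 * m) ?G + 8"
    using assms by (intro mod_chromatic_index_lower finite_simple_hexagon) auto
  moreover have "(2 * m, ?G) \<in> bipartite_family"
    using assms connected_hexagon_minus_two[of m "hexagon_edges m"]
      degree_set_hexagon_degrees[of m "hexagon_edges m"] finite_simple_hexagon bipartite_hexagon
    unfolding bipartite_family_def by auto
  ultimately show ?thesis by blast
qed

lemma nonbipartite_family_lower:
  assumes m: "2 \<le> m"
  shows "\<exists>G. (2 * m, G) \<in> nonbipartite_family \<and> 9 * (2 * m) \<le> 8 * mod_chromatic_index (2 * m) G + 8"
proof -
  \<comment> \<open>The vertices 0 and 3 share a residue, as do \<open>6 * m + 1\<close> and \<open>6 * m + 4\<close>, so 0 and 3 keep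
    the common neighbour \<open>6 * m + 2\<close> and form a triangle with it once they are joined.\<close>
  define E where "E = switch 0 (6 * m + 1) 3 (6 * m + 4) (hexagon_edges m)"
  let ?G = "({..<9 * m}, E)"
  have mod3_Suc: "Suc (6 * m) mod 3 = 1"
    using add_six_mult_mod3[of m 1] by simp
  have high: "{6 * m + 1, 6 * m + 4} \<notin> hexagon_edges m"
    by (auto simp: doubleton_eq_iff elim: hexagon_edgeE)
  have deg: "vertex_degree ({..<9 * m}, E) v = vertex_degree ({..<9 * m}, hexagon_edges m) v" for v
    unfolding E_def
    using m high finite_edges[OF finite_simple_hexagon[of m]]
    by (intro switch_degree) (auto simp: hexagon_edge_iff add_six_mult_mod3 mod3_Suc)
  have sub: "hexagon_edges m - {{0, 6 * m + 1}, {3, 6 * m + 4}} \<subseteq> E"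
    unfolding E_def switch_def by auto
  have fsg: "finite_simple_graph ?G"
    using m finite_simple_hexagon[of m]
    unfolding finite_simple_graph_def E_def switch_def by auto
  have "\<not> bipartite ?G"
  proof (rule triangle_not_bipartite)
    show "{0, 3} \<in> edges ?G" by (simp add: E_def switch_def)
    have "{0, 6 * m + 2} \<in> hexagon_edges m" "{3, 6 * m + 2} \<in> hexagon_edges m"
      using m add_six_mult_mod3[of m 2] by (auto simp: hexagon_edge_iff)
    then show "{3, 6 * m + 2} \<in> edges ?G" "{0, 6 * m + 2} \<in> edges ?G"
      using sub by (auto simp: doubleton_eq_iff)
  qed
  then have "(2 * m, ?G) \<in> nonbipartite_family"
    using m connected_hexagon_minus_two[OF m sub] degree_set_hexagon_degrees[of m E] fsg deg
    unfolding nonbipartite_family_def by auto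
  moreover have "9 * (2 * m) \<le> 8 * mod_chromatic_index (2 * m) ?G + 8"
    using m fsg deg sub by (rule mod_chromatic_index_lower)
  ultimately show ?thesis by blast
qed

theorem corollary1p4:
  fixes F :: "(nat \<times> nat graph) set"
  assumes "F = bipartite_family \<or> F = nonbipartite_family"
  shows "\<not> (\<exists>C :: real. \<forall>(k, G)\<in>F. real (mod_chromatic_index k G) \<le> real k + C) \<and>
         \<not> (\<exists>f :: nat \<Rightarrow> real. f \<in> o(\<lambda>k. real k) \<and>
             (\<forall>(k, G)\<in>F. real (mod_chromatic_index k G) \<le> real k + f k))"
proof -
  have little_o: False
    if f: "f \<in> o(\<lambda>k. real k)"
      and bound: "\<forall>(k, G)\<in>F. real (mod_chromatic_index k G) \<le> real k + f k"
    for f :: "nat \<Rightarrow> real"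
  proof -
    have "eventually (\<lambda>k. norm (f k) \<le> 1 / 16 * norm (real k)) sequentially"
      using f by (rule landau_o.smallD) simp
    then obtain K where K: "\<And>k. K \<le> k \<Longrightarrow> norm (f k) \<le> 1 / 16 * norm (real k)"
      unfolding eventually_sequentially by blast
    \<comment> \<open>With \<open>k = 2 * m\<close> the two bounds give \<open>9 * k / 8 - 1 \<le> k + k / 16\<close>, that is \<open>m \<le> 8\<close>.\<close>
    define m where "m = K + 9"
    obtain G where G: "(2 * m, G) \<in> F" "9 * (2 * m) \<le> 8 * mod_chromatic_index (2 * m) G + 8"
      using assms bipartite_family_lower[of m] nonbipartite_family_lower[of m]
      unfolding m_def by auto
    have "real (9 * (2 * m)) \<le> real (8 * mod_chromatic_index (2 * m) G + 8)"
      using G(2) by (simp only: of_nat_le_iff)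
    moreover have "real (mod_chromatic_index (2 * m) G) \<le> real (2 * m) + f (2 * m)"
      using bound G(1) by blast
    moreover have "f (2 * m) \<le> real (2 * m) / 16"
      using K[of "2 * m"] by (simp add: m_def)
    ultimately have "real m \<le> 8" by simp
    then show False by (simp add: m_def)
  qed
  have "(\<lambda>k. C) \<in> o(\<lambda>k. real k)" for C :: real
    by (rule smalloI_tendsto) (simp_all add: lim_const_over_n eventually_gt_at_top)
  then show ?thesis using little_o by blast
qed

end
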